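(* Let $r \geq 4$ be an integer and let $C_r$ be the cycle on $r$ vertices. Then $$1 \leq \liminf_{n\to\infty} \frac{\operatorname{csat}(n,C_r)}{n} \leq \limsup_{n\to\infty} \frac{\operatorname{csat}(n,C_r)}{n} \leq 1 + \frac{1}{r-3}.$$
   Context: All graphs are simple, finite and undirected, and have at least one edge. A "copy of $F$" in $G$ is a (not necessarily induced) subgraph of $G$ isomorphic to $F$. A graph $G$ is $F$-covered if every edge of $G$ lies in a copy of $F$ in $G$. A graph $G$ is $F$-semi-saturated if for every edge $e$ of the complement of $G$, the graph $G+e$ contains more copies of $F$ than $G$ does (equivalently, $G+e$ contains a copy of $F$ using $e$). A graph is $F$-cov-sat if it is both $F$-covered and $F$-semi-saturated. For $n \geq |F|$ (where $|F|$ is the number of vertices of $F$), $\operatorname{csat}(n,F)$ is the minimum number of edges of an $F$-cov-sat graph on exactly $n$ vertices. *)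

theory Defs
  imports Complex_Main "HOL-Library.Extended_Real" "HOL-Library.Liminf_Limsup"
begin

type_synonym 'a ugraph = "'a set \<times> 'a set set"

abbreviation verts :: "'a ugraph \<Rightarrow> 'a set" where "verts G \<equiv> fst G"
abbreviation edges :: "'a ugraph \<Rightarrow> 'a set set" where "edges G \<equiv> snd G"

text \<open>Standing convention: every graph is finite, simple, undirected and has at least one edge.\<close>

definition graph :: "'a ugraph \<Rightarrow> bool" where
  "graph G \<longleftrightarrow> finite (verts G) \<and> (\<forall>e\<in>edges G. e \<subseteq> verts G \<and> card e = 2) \<and> edges G \<noteq> {}"

definition subgraph :: "'a ugraph \<Rightarrow> 'a ugraph \<Rightarrow> bool" where
  "subgraph H G \<longleftrightarrow> graph H \<and> verts H \<subseteq> verts G \<and> edges H \<subseteq> edges G"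

definition isomorphic :: "'a ugraph \<Rightarrow> 'b ugraph \<Rightarrow> bool" where
  "isomorphic G H \<longleftrightarrow> (\<exists>f. bij_betw f (verts G) (verts H) \<and> (\<lambda>e. f ` e) ` edges G = edges H)"

definition copies :: "'b ugraph \<Rightarrow> 'a ugraph \<Rightarrow> 'a ugraph set" where
  "copies F G = {H. subgraph H G \<and> isomorphic H F}"

definition covered :: "'b ugraph \<Rightarrow> 'a ugraph \<Rightarrow> bool" where
  "covered F G \<longleftrightarrow> (\<forall>e\<in>edges G. \<exists>H\<in>copies F G. e \<in> edges H)"

definition complement_edges :: "'a ugraph \<Rightarrow> 'a set set" where
  "complement_edges G = {e. e \<subseteq> verts G \<and> card e = 2 \<and> e \<notin> edges G}"

definition add_edge :: "'a ugraph \<Rightarrow> 'a set \<Rightarrow> 'a ugraph" where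
  "add_edge G e = (verts G, insert e (edges G))"

definition semi_saturated :: "'b ugraph \<Rightarrow> 'a ugraph \<Rightarrow> bool" where
  "semi_saturated F G \<longleftrightarrow>
     (\<forall>e\<in>complement_edges G. card (copies F G) < card (copies F (add_edge G e)))"

definition cov_sat :: "'b ugraph \<Rightarrow> 'a ugraph \<Rightarrow> bool" where
  "cov_sat F G \<longleftrightarrow> covered F G \<and> semi_saturated F G"

text \<open>Every finite graph is isomorphic to one whose vertices are natural numbers, so it suffices
  to minimise over those. If \<open>F\<close> is a graph and \<open>n \<ge> card (verts F)\<close>, the complete graph on \<open>n\<close>
  vertices shows that the minimum is attained; for smaller \<open>n\<close> the value is not meaningful.\<close>

definition csat :: "nat \<Rightarrow> 'b ugraph \<Rightarrow> nat" where
  "csat n F = (LEAST m. \<exists>G :: nat ugraph.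
     graph G \<and> card (verts G) = n \<and> cov_sat F G \<and> card (edges G) = m)"

text \<open>A simple cycle only for \<open>r \<ge> 3\<close>.\<close>

definition cycle_graph :: "nat \<Rightarrow> nat ugraph" where
  "cycle_graph r = ({..<r}, (\<lambda>i. {i, Suc i mod r}) ` {..<r})"

end

theory Submission
  imports Defs
begin

text \<open>
  Lower bound. In a \<open>C\<^sub>r\<close>-cov-sat graph every vertex has degree at least 2, so there are at least as
  many edges as vertices. Indeed a vertex on some edge lies, by coverage, on a cycle; and no vertex
  is isolated, because an edge added at an isolated vertex would be its only edge and hence would
  lie on no cycle.

  Upper bound. Write \<open>w = r - 3\<close>. Take a clique on \<open>k \<ge> r\<close> vertices, two of which are \<open>0\<close> and \<open>1\<close>,
  and attach \<open>q\<close> ears: disjoint paths from \<open>0\<close> to \<open>1\<close>, each with \<open>w\<close> inner vertices and thus \<open>w + 1\<close>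
  edges. In this graph any two distinct vertices are the ends of a path on exactly \<open>r\<close> vertices
  (\<open>ear_ear_joined\<close>, \<open>ear_clique_joined\<close>, \<open>clique_clique_joined\<close>). This single property yields both
  halves of being cov-sat (\<open>all_r_joined_imp_cov_sat\<close>): the edge between the two ends, be it present
  or newly added, closes the path to a copy of \<open>C\<^sub>r\<close>.

  The length \<open>w + 1\<close> of an ear is what makes the paths exist. Let \<open>x\<close> be the vertex at distance \<open>s\<close> from
  \<open>0\<close> along one ear and \<open>y\<close> the vertex at distance \<open>t \<ge> s\<close> from \<open>0\<close> along the same or another ear.
  Walk from \<open>x\<close> back to \<open>0\<close>, through the clique to \<open>1\<close>, and from \<open>1\<close> back to \<open>y\<close>: on the
  two ears this meets \<open>(s + 1) + (w + 2 - t)\<close> vertices, so a detour through \<open>t - s\<close> further clique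
  vertices makes the total \<open>w + 3 = r\<close>. The clique has enough vertices for every such detour.

  Keeping \<open>k \<le> 2 w + 3\<close> and letting \<open>q\<close> grow reaches every number of vertices from \<open>r\<close> on. Each ear
  contributes \<open>w + 1\<close> edges for \<open>w\<close> vertices, which gives the slope \<open>1 + 1 / w\<close>.
\<close>

section \<open>Copies of cycles\<close>

lemma copies_add_edge_mono: "copies F G \<subseteq> copies F (add_edge G e)"
  by (auto simp: copies_def subgraph_def add_edge_def)

lemma finite_copies:
  assumes "finite (verts G)"
  shows "finite (copies F G)"
proof (rule finite_subset)
  show "copies F G \<subseteq> Pow (verts G) \<times> Pow (Pow (verts G))"
    by (force simp: copies_def subgraph_def graph_def)
qed (use assms in simp)

text \<open>
  Adding an edge never destroys a copy, and there are finitely many copies; so having more of them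
  is the same as having a new one. All later arguments speak of a new copy instead of counting.
\<close>

lemma new_copy_iff:
  assumes "finite (verts G)"
  shows "card (copies F G) < card (copies F (add_edge G e)) \<longleftrightarrow>
    (\<exists>H\<in>copies F (add_edge G e). H \<notin> copies F G)"
proof -
  have "finite (copies F (add_edge G e))"
    using assms by (intro finite_copies) (simp add: add_edge_def)
  then show ?thesis
    using copies_add_edge_mono[of F G e] psubset_card_mono[of "copies F (add_edge G e)" "copies F G"]
    by (metis less_irrefl psubsetI subsetI subset_antisym)
qed

lemma copy_of_cycle_two_edges:
  assumes r: "3 \<le> r" and H: "H \<in> copies (cycle_graph r) G" and v: "v \<in> verts H"
  shows "\<exists>e1\<in>edges H. \<exists>e2\<in>edges H. e1 \<noteq> e2 \<and> v \<in> e1 \<and> v \<in> e2"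
proof -
  obtain f where f: "bij_betw f (verts H) {..<r}"
    and fe: "(\<lambda>e. f ` e) ` edges H = (\<lambda>i. {i, Suc i mod r}) ` {..<r}"
    and sub: "\<And>e. e \<in> edges H \<Longrightarrow> e \<subseteq> verts H"
    using H by (auto simp: copies_def isomorphic_def cycle_graph_def subgraph_def graph_def)
  define i where "i = f v"
  \<comment> \<open>The cyclic predecessor of \<open>i\<close>; it differs from the successor because \<open>r \<ge> 3\<close>.\<close>
  define h where "h = (if i = 0 then r - 1 else i - 1)"
  have i: "i < r" using f v by (auto simp: i_def bij_betw_def)
  have h: "h < r" "Suc h mod r = i" "h \<noteq> Suc i mod r" "h \<noteq> i" "i \<noteq> Suc i mod r"
    using i r by (auto simp: h_def mod_Suc)
  obtain e1 where e1: "e1 \<in> edges H" "f ` e1 = {i, Suc i mod r}"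
    using fe i by (metis (no_types, lifting) image_iff lessThan_iff)
  obtain e2 where e2: "e2 \<in> edges H" "f ` e2 = {h, i}"
    using fe h by (metis (no_types, lifting) image_iff lessThan_iff)
  have mem: "v \<in> e" if "e \<in> edges H" "i \<in> f ` e" for e
    using that sub v f unfolding i_def
    by (metis bij_betw_imp_inj_on inj_on_image_mem_iff)
  have "e1 \<noteq> e2" using e1 e2 h by (metis doubleton_eq_iff)
  then show ?thesis using e1 e2 mem by blast
qed

text \<open>
  The relation counts the vertices of the path, not its edges, so that an edge between the two ends
  closes it to a cycle of length exactly \<open>r\<close>.
\<close>

definition r_joined :: "nat \<Rightarrow> 'a ugraph \<Rightarrow> 'a \<Rightarrow> 'a \<Rightarrow> bool" where
  "r_joined r G u v \<longleftrightarrow> (\<exists>p. distinct p \<and> length p = r \<and> set p \<subseteq> verts G \<and>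
     successively (\<lambda>x y. {x, y} \<in> edges G) p \<and> hd p = u \<and> last p = v)"

lemma r_joined_sym: "r_joined r G u v \<Longrightarrow> r_joined r G v u"
proof -
  assume "r_joined r G u v"
  then obtain p where "distinct p \<and> length p = r \<and> set p \<subseteq> verts G \<and>
     successively (\<lambda>x y. {x, y} \<in> edges G) p \<and> hd p = u \<and> last p = v"
    unfolding r_joined_def by blast
  then show ?thesis unfolding r_joined_def
    by (intro exI[of _ "rev p"]) (auto simp: hd_rev last_rev insert_commute)
qed

lemma r_joined_closes_cycle:
  assumes r: "3 \<le> r" and uv: "r_joined r G u v" "{u, v} \<in> edges G"
  shows "\<exists>H\<in>copies (cycle_graph r) G. {u, v} \<in> edges H"
proof -
  obtain p where p: "distinct p" "length p = r" "set p \<subseteq> verts G"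
    "successively (\<lambda>x y. {x, y} \<in> edges G) p" "hd p = u" "last p = v"
    using uv unfolding r_joined_def by blast
  define c where "c i = {p ! i, p ! (Suc i mod r)}" for i
  have lst: "c (r - 1) = {u, v}"
  proof -
    have "p \<noteq> []" using p r by auto
    then have "p ! 0 = u" "p ! (r - 1) = v"
      using p hd_conv_nth[of p] last_conv_nth[of p] by simp_all
    then show ?thesis using r by (simp add: c_def insert_commute)
  qed
  have cE: "c i \<in> edges G" if "i < r" for i
  proof (cases "Suc i < r")
    case True
    then show ?thesis using p by (auto simp: c_def successively_conv_nth)
  next
    case False
    with that have "i = r - 1" by simp
    then show ?thesis using lst uv by simp
  qed
  have c2: "card (c i) = 2" "c i \<subseteq> set p" if "i < r" for i
  proof -
    have "i \<noteq> Suc i mod r" "Suc i mod r < r" using that r by (auto simp: mod_Suc)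
    then show "card (c i) = 2" "c i \<subseteq> set p"
      using p that by (auto simp: c_def nth_eq_iff_index_eq)
  qed
  define H where "H = (set p, c ` {..<r})"
  define f where "f = inv_into {..<r} (nth p)"
  have b: "bij_betw (nth p) {..<r} (set p)"
    using p by (intro bij_betw_nth) auto
  have "bij_betw f (set p) {..<r}" unfolding f_def using b by (rule bij_betw_inv_into)
  moreover have fc: "f ` c i = {i, Suc i mod r}" if "i < r" for i
    using that r b unfolding f_def c_def by (simp add: bij_betw_inv_into_left)
  have "(\<lambda>e. f ` e) ` c ` {..<r} = (\<lambda>i. {i, Suc i mod r}) ` {..<r}"
    unfolding image_image using fc by (intro image_cong) auto
  ultimately have "isomorphic H (cycle_graph r)"
    unfolding isomorphic_def cycle_graph_def H_def by auto
  moreover have "subgraph H G"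
  proof -
    have "c 0 \<in> c ` {..<r}" using r by simp
    then have "c ` {..<r} \<noteq> {}" by blast
    then show ?thesis using p c2 cE by (auto simp: subgraph_def graph_def H_def)
  qed
  ultimately have "H \<in> copies (cycle_graph r) G" by (simp add: copies_def)
  moreover have "{u, v} \<in> edges H"
    unfolding H_def snd_conv lst[symmetric] using r by (intro imageI) simp
  ultimately show ?thesis by blast
qed

text \<open>
  Demanding the path also between adjacent vertices is what adds coverage to semi-saturation. For a
  missing edge, the path survives in the larger graph, and the cycle that it closes is a new copy
  because it uses the added edge.
\<close>

lemma all_r_joined_imp_cov_sat:
  assumes r: "3 \<le> r" and G: "graph G"
    and joined: "\<And>u v. u \<in> verts G \<Longrightarrow> v \<in> verts G \<Longrightarrow> u \<noteq> v \<Longrightarrow> r_joined r G u v"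
  shows "cov_sat (cycle_graph r) G"
  unfolding cov_sat_def
proof
  have fin: "finite (verts G)" using G by (simp add: graph_def)
  show "covered (cycle_graph r) G"
    unfolding covered_def
  proof
    fix e assume e: "e \<in> edges G"
    then obtain u v where "e = {u, v}" "u \<noteq> v" "u \<in> verts G" "v \<in> verts G"
      using G unfolding graph_def by (metis card_2_iff insert_subset)
    then show "\<exists>H\<in>copies (cycle_graph r) G. e \<in> edges H"
      using r_joined_closes_cycle[OF r, of G] joined e by blast
  qed
  show "semi_saturated (cycle_graph r) G"
    unfolding semi_saturated_def
  proof
    fix e assume e: "e \<in> complement_edges G"
    then obtain u v where uv: "e = {u, v}" "u \<noteq> v" "u \<in> verts G" "v \<in> verts G"
      unfolding complement_edges_def by (auto simp: card_2_iff)
    have "r_joined r (add_edge G e) u v"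
      using joined[OF uv(3,4,2)] unfolding r_joined_def
      by (auto simp: add_edge_def intro: successively_mono)
    then have "\<exists>H\<in>copies (cycle_graph r) (add_edge G e). e \<in> edges H"
      using r_joined_closes_cycle[OF r, of "add_edge G e" u v] uv
      by (simp add: add_edge_def)
    moreover have "H \<notin> copies (cycle_graph r) G" if "e \<in> edges H" for H
      using that e by (auto simp: copies_def subgraph_def complement_edges_def)
    ultimately show "card (copies (cycle_graph r) G) < card (copies (cycle_graph r) (add_edge G e))"
      using new_copy_iff[OF fin] by blast
  qed
qed

section \<open>The lower bound\<close>

text \<open>
  Coverage gives two edges at any vertex that has one. An isolated vertex \<open>v\<close> is excluded by joining
  it to an endpoint \<open>w\<close> of some edge: a new cycle would need two edges at \<open>v\<close>, but only \<open>{v, w}\<close>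
  is there.
\<close>

lemma cov_sat_cycle_two_edges_at:
  assumes r: "3 \<le> r" and G: "graph G" and cs: "cov_sat (cycle_graph r) G" and v: "v \<in> verts G"
  shows "\<exists>e1\<in>edges G. \<exists>e2\<in>edges G. e1 \<noteq> e2 \<and> v \<in> e1 \<and> v \<in> e2"
proof -
  have fin: "finite (verts G)" using G by (simp add: graph_def)
  have "\<exists>e\<in>edges G. v \<in> e"
  proof (rule ccontr)
    assume isol: "\<not> (\<exists>e\<in>edges G. v \<in> e)"
    obtain e' where "e' \<in> edges G" using G by (auto simp: graph_def)
    then obtain w where w: "w \<in> e'" "w \<in> verts G" "w \<noteq> v"
      using G isol unfolding graph_def by (metis card_2_iff insertI1 insert_subset)
    have "{v, w} \<in> complement_edges G"
      using w v isol by (auto simp: complement_edges_def)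
    then obtain H where H: "H \<in> copies (cycle_graph r) (add_edge G {v, w})"
      and new: "H \<notin> copies (cycle_graph r) G"
      using cs new_copy_iff[OF fin] unfolding cov_sat_def semi_saturated_def by blast
    have sub: "edges H \<subseteq> insert {v, w} (edges G)"
      using H by (simp add: copies_def subgraph_def add_edge_def)
    have "{v, w} \<in> edges H"
      using H new by (auto simp: copies_def subgraph_def add_edge_def)
    then have "v \<in> verts H"
      using H by (auto simp: copies_def subgraph_def graph_def)
    then show False
      using copy_of_cycle_two_edges[OF r H] sub isol by blast
  qed
  then obtain e where e: "e \<in> edges G" "v \<in> e" by blast
  then obtain H where H: "H \<in> copies (cycle_graph r) G" "e \<in> edges H"
    using cs unfolding cov_sat_def covered_def by blast
  then have sub: "edges H \<subseteq> edges G" and "v \<in> verts H"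
    using e by (auto simp: copies_def subgraph_def graph_def)
  then obtain e1 e2 where "e1 \<in> edges H" "e2 \<in> edges H" "e1 \<noteq> e2 \<and> v \<in> e1 \<and> v \<in> e2"
    using copy_of_cycle_two_edges[OF r H(1)] by metis
  with sub show ?thesis by (meson subsetD)
qed

text \<open>Double counting of the incidences between vertices and edges.\<close>

lemma card_verts_le_card_edges:
  assumes G: "graph G"
    and deg: "\<And>v. v \<in> verts G \<Longrightarrow> \<exists>e1\<in>edges G. \<exists>e2\<in>edges G. e1 \<noteq> e2 \<and> v \<in> e1 \<and> v \<in> e2"
  shows "card (verts G) \<le> card (edges G)"
proof -
  have finV: "finite (verts G)" using G by (simp add: graph_def)
  have "edges G \<subseteq> Pow (verts G)" using G unfolding graph_def by blast
  then have finE: "finite (edges G)" using finV by (simp add: finite_subset)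
  have two: "2 \<le> card {e \<in> edges G. v \<in> e}" if v: "v \<in> verts G" for v
  proof -
    obtain e1 e2 where e: "e1 \<in> edges G" "e2 \<in> edges G" "e1 \<noteq> e2" "v \<in> e1" "v \<in> e2"
      using deg[OF v] by blast
    then have "{e1, e2} \<subseteq> {e \<in> edges G. v \<in> e}" "card {e1, e2} = 2" by auto
    then show ?thesis using finE card_mono[of "{e \<in> edges G. v \<in> e}" "{e1, e2}"] by simp
  qed
  have "2 * card (verts G) \<le> (\<Sum>v\<in>verts G. card {e \<in> edges G. v \<in> e})"
    using sum_bounded_below[of "verts G" 2 "\<lambda>v. card {e \<in> edges G. v \<in> e}"] two
    by (simp add: mult.commute)
  also have "\<dots> = 2 * card (edges G)"
  proof (rule sum_multicount)
    show "\<forall>e\<in>edges G. card {v \<in> verts G. v \<in> e} = 2"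
    proof
      fix e assume "e \<in> edges G"
      then have "{v \<in> verts G. v \<in> e} = e" "card e = 2" using G by (auto simp: graph_def)
      then show "card {v \<in> verts G. v \<in> e} = 2" by simp
    qed
  qed (fact finV finE)+
  finally show ?thesis by simp
qed

section \<open>A clique with ears\<close>

text \<open>
  The clique lives on \<open>{..<k}\<close>, and ear \<open>j\<close> occupies the \<open>j\<close>-th block of \<open>w\<close> consecutive numbers
  starting at \<open>k\<close>. Positions \<open>s = 0\<close> and \<open>s = Suc w\<close> of every ear are the shared attachment vertices
  \<open>0\<close> and \<open>1\<close>. Including them in the numbering makes all \<open>w + 1\<close> edges of an ear uniform, and lets
  statements about two ear vertices cover the attachment vertices as well.
\<close>

definition ear_vertex :: "nat \<Rightarrow> nat \<Rightarrow> nat \<Rightarrow> nat \<Rightarrow> nat" where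
  "ear_vertex k w j s = (if s = 0 then 0 else if s = Suc w then 1 else k + j * w + (s - 1))"

definition eared_clique :: "nat \<Rightarrow> nat \<Rightarrow> nat \<Rightarrow> nat ugraph" where
  "eared_clique k w q = ({..<k + q * w}, {e. e \<subseteq> {..<k} \<and> card e = 2} \<union>
     (\<lambda>(j, s). {ear_vertex k w j s, ear_vertex k w j (Suc s)}) ` ({..<q} \<times> {..w}))"

text \<open>Ears are disjoint except for the attachment vertices: division by \<open>w\<close> recovers ear and position.\<close>

lemma ear_vertex_eqD:
  assumes "ear_vertex k w i s = ear_vertex k w j t" "s \<le> Suc w" "t \<le> Suc w" "2 \<le> k"
  shows "s = t \<and> (i = j \<or> s = 0 \<or> s = Suc w)"
proof (cases "s \<in> {1..w} \<and> t \<in> {1..w}")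
  case True
  then have eq: "i * w + (s - 1) = j * w + (t - 1)" and lt: "s - 1 < w" "t - 1 < w"
    using assms by (auto simp: ear_vertex_def split: if_splits)
  have "i = j" using arg_cong[OF eq, of "\<lambda>x. x div w"] lt by simp
  moreover have "s - 1 = t - 1" using arg_cong[OF eq, of "\<lambda>x. x mod w"] lt by simp
  ultimately show ?thesis using True by auto
next
  case False
  then show ?thesis using assms by (auto simp: ear_vertex_def split: if_splits)
qed

lemma ear_vertex_ends [simp]: "ear_vertex k w j 0 = 0" "ear_vertex k w j (Suc w) = 1"
  by (auto simp: ear_vertex_def)

lemma ear_vertex_lt:
  assumes "j < q" "s \<le> Suc w" "2 \<le> k"
  shows "ear_vertex k w j s < k + q * w"
proof (cases "s = 0 \<or> s = Suc w")
  case False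
  have "j * w + w \<le> q * w"
    using assms(1) by (metis Suc_leI add.commute mult_Suc mult_le_mono1)
  then show ?thesis using False assms by (auto simp: ear_vertex_def)
qed (use assms in \<open>auto simp: ear_vertex_def\<close>)

lemma ear_vertex_in_clique:
  assumes "ear_vertex k w j s < k" "s \<le> Suc w"
  shows "ear_vertex k w j s < 2"
  using assms by (auto simp: ear_vertex_def split: if_splits)

lemma eared_clique_vertex_cases:
  assumes "v < k + q * w"
  obtains "v < k" | j s where "j < q" "1 \<le> s" "s \<le> w" "v = ear_vertex k w j s"
proof (cases "v < k")
  case False
  define d where "d = v - k"
  have d: "d < q * w" "v = k + d" using False assms by (auto simp: d_def)
  then have "0 < w" by (cases w) auto
  then have "d div w < q" "d mod w < w" using d by (auto simp: less_mult_imp_div_less)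
  then have "v = ear_vertex k w (d div w) (Suc (d mod w))"
    using d by (simp add: ear_vertex_def)
  with \<open>d div w < q\<close> \<open>d mod w < w\<close> that(2)[of "d div w" "Suc (d mod w)"] show thesis by simp
qed (use that in blast)

lemma graph_eared_clique:
  assumes "2 \<le> k"
  shows "graph (eared_clique k w q)"
proof -
  have "{0, 1} \<in> edges (eared_clique k w q)" using assms by (simp add: eared_clique_def)
  moreover have "e \<subseteq> verts (eared_clique k w q) \<and> card e = 2"
    if "e \<in> edges (eared_clique k w q)" for e
    using that unfolding eared_clique_def
  proof (simp, elim disjE)
    assume "e \<in> (\<lambda>(j, s). {ear_vertex k w j s, ear_vertex k w j (Suc s)}) ` ({..<q} \<times> {..w})"
    then obtain j s where e: "j < q" "s \<le> w" "e = {ear_vertex k w j s, ear_vertex k w j (Suc s)}"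
      by auto
    have "ear_vertex k w j s \<noteq> ear_vertex k w j (Suc s)"
      using ear_vertex_eqD[of k w j s j "Suc s"] assms e by auto
    then show "e \<subseteq> {..<k + q * w} \<and> card e = 2"
      using e assms ear_vertex_lt[of j q s w k] ear_vertex_lt[of j q "Suc s" w k] by simp
  qed auto
  moreover have "finite (verts (eared_clique k w q))" by (simp add: eared_clique_def)
  ultimately show ?thesis unfolding graph_def by blast
qed

text \<open>The crude bound \<open>2 ^ k\<close> for the clique is enough, as \<open>k\<close> will stay bounded while \<open>q\<close> grows.\<close>

lemma card_edges_eared_clique:
  "card (edges (eared_clique k w q)) \<le> 2 ^ k + q * Suc w"
proof -
  have "card {e. e \<subseteq> {..<k} \<and> card e = 2} \<le> card (Pow {..<k})"
    by (intro card_mono) auto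
  also have "\<dots> = 2 ^ k" by (simp add: card_Pow)
  finally have A: "card {e. e \<subseteq> {..<k} \<and> card e = 2} \<le> 2 ^ k" .
  have B: "card ((\<lambda>(j, s). {ear_vertex k w j s, ear_vertex k w j (Suc s)}) ` ({..<q} \<times> {..w}))
      \<le> q * Suc w"
    by (rule order_trans[OF card_image_le]) auto
  show ?thesis unfolding eared_clique_def snd_conv
    by (rule order_trans[OF card_Un_le]) (use A B in linarith)
qed

lemma ex_distinct_list:
  assumes "m \<le> card S"
  shows "\<exists>ys. distinct ys \<and> length ys = m \<and> set ys \<subseteq> S"
  using assms by (metis distinct_card finite_distinct_list obtain_subset_with_card_n)

lemma successively_clique:
  assumes "distinct zs" "set zs \<subseteq> {..<k}"
  shows "successively (\<lambda>x y. {x, y} \<in> edges (eared_clique k w q)) zs"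
  using assms by (induction zs rule: induct_list012) (simp_all add: eared_clique_def)

lemma successively_ear:
  assumes "j < q" "b \<le> w + 2"
  shows "successively (\<lambda>x y. {x, y} \<in> edges (eared_clique k w q)) (map (ear_vertex k w j) [a..<b])"
  unfolding successively_conv_nth
proof (intro allI impI)
  fix i assume "Suc i < length (map (ear_vertex k w j) [a..<b])"
  then have "a + Suc i < b" by simp
  moreover from this have "(j, a + i) \<in> {..<q} \<times> {..w}" using assms by simp
  ultimately show "{map (ear_vertex k w j) [a..<b] ! i, map (ear_vertex k w j) [a..<b] ! Suc i}
      \<in> edges (eared_clique k w q)"
    unfolding eared_clique_def snd_conv
    by (intro UnI2 image_eqI[of _ _ "(j, a + i)"]) simp_all
qed

lemma distinct_ear:
  assumes "b \<le> w + 2" "2 \<le> k"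
  shows "distinct (map (ear_vertex k w j) [a..<b])"
proof -
  have "s = t" if "ear_vertex k w j s = ear_vertex k w j t" "s < b" "t < b" for s t
    using ear_vertex_eqD[OF that(1)] that assms by simp
  then show ?thesis by (auto simp: distinct_map inj_on_def)
qed

text \<open>The initial stretch of an ear, walked from position \<open>s\<close> towards the clique.\<close>

definition ear_start :: "nat \<Rightarrow> nat \<Rightarrow> nat \<Rightarrow> nat \<Rightarrow> nat list" where
  "ear_start k w i s = rev (map (ear_vertex k w i) [0..<Suc s])"

lemma ear_start:
  assumes "2 \<le> k" "i < q" "s \<le> w"
  shows "distinct (ear_start k w i s)"
    "successively (\<lambda>x y. {x, y} \<in> edges (eared_clique k w q)) (ear_start k w i s)"
    "hd (ear_start k w i s) = ear_vertex k w i s" "last (ear_start k w i s) = 0"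
    "length (ear_start k w i s) = Suc s" "ear_start k w i s \<noteq> []"
    "set (ear_start k w i s) = ear_vertex k w i ` {..s}"
proof -
  show "distinct (ear_start k w i s)"
    using distinct_ear[of "Suc s" w k i 0] assms by (simp add: ear_start_def del: upt_Suc)
  show "successively (\<lambda>x y. {x, y} \<in> edges (eared_clique k w q)) (ear_start k w i s)"
    using successively_ear[of i q "Suc s" w k 0] assms
    by (simp add: ear_start_def insert_commute del: upt_Suc)
  show "hd (ear_start k w i s) = ear_vertex k w i s" by (simp add: ear_start_def)
  show "last (ear_start k w i s) = 0"
    by (simp add: ear_start_def last_rev hd_map del: upt_Suc)
  show "length (ear_start k w i s) = Suc s" "ear_start k w i s \<noteq> []"
    by (simp_all add: ear_start_def)
  show "set (ear_start k w i s) = ear_vertex k w i ` {..s}"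
    by (simp add: ear_start_def atLeast0LessThan lessThan_Suc_atMost del: upt_Suc)
qed

text \<open>
  The heart of the construction: \<open>X\<close> leads down ear \<open>i\<close> to \<open>0\<close>, \<open>Y\<close> is a detour through \<open>t - s\<close> clique
  vertices other than \<open>0\<close> and \<open>1\<close>, and \<open>Z\<close> leads from \<open>1\<close> down ear \<open>j\<close>. The lengths \<open>s + 1\<close>,
  \<open>t - s\<close> and \<open>w + 2 - t\<close> add up to \<open>w + 3\<close>. On a common ear \<open>X\<close> and \<open>Z\<close> do not meet as \<open>s < t\<close>. The case
  \<open>s = 0\<close> starts at the attachment vertex \<open>0\<close>, the case \<open>t = Suc w\<close> ends at \<open>1\<close>.
\<close>

lemma ear_ear_joined:
  assumes k: "w + 3 \<le> k" and ij: "i < q" "j < q"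
    and st: "s \<le> t" "s \<le> w" "1 \<le> t" "t \<le> Suc w" "s < t \<or> i \<noteq> j"
  shows "r_joined (w + 3) (eared_clique k w q) (ear_vertex k w i s) (ear_vertex k w j t)"
proof -
  let ?G = "eared_clique k w q"
  let ?A = "\<lambda>x y. {x, y} \<in> edges ?G"
  define X where "X = ear_start k w i s"
  define Y where "Y = [2..<2 + (t - s)]"
  define Z where "Z = rev (map (ear_vertex k w j) [t..<w + 2])"
  have k2: "2 \<le> k" using k by simp
  note X = ear_start[OF k2 ij(1) st(2), folded X_def]
  have Z: "distinct Z" "successively ?A Z"
    using distinct_ear[of "w + 2" w k j t] successively_ear[of j q "w + 2" w k t] k2 ij
    by (simp_all add: Z_def insert_commute del: upt_Suc)
  have Z_ends: "Z \<noteq> []" "hd Z = 1" "last Z = ear_vertex k w j t"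
  proof -
    have ne: "[t..<w + 2] \<noteq> []" using st by (simp del: upt_Suc)
    then show "Z \<noteq> []" by (simp add: Z_def)
    show "last Z = ear_vertex k w j t" using ne st by (simp add: Z_def last_rev hd_map del: upt_Suc)
    show "hd Z = 1" using ne st by (simp add: Z_def hd_rev last_map del: upt_Suc)
  qed
  have setZ: "set Z = ear_vertex k w j ` {t..Suc w}"
    by (simp add: Z_def atLeastLessThanSuc_atLeastAtMost flip: atLeastLessThan_upt del: upt_Suc)
  have setY: "set Y = {2..<2 + (t - s)}" by (simp add: Y_def del: upt_Suc)
  have XZ: "set X \<inter> set Z = {}"
  proof (rule ccontr)
    assume "set X \<inter> set Z \<noteq> {}"
    then obtain a b where ab: "a \<le> s" "t \<le> b" "b \<le> Suc w"
      "ear_vertex k w i a = ear_vertex k w j b"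
      using X(7) setZ by auto
    then show False using ear_vertex_eqD[OF ab(4)] k2 st by auto
  qed
  have Y: "y \<noteq> ear_vertex k w l a" if "y \<in> set Y" "a \<le> Suc w" for y l a
  proof
    assume "y = ear_vertex k w l a"
    moreover have "2 \<le> y" "y < k" using that k st setY by auto
    ultimately show False using ear_vertex_in_clique[of k w l a] that by simp
  qed
  have "set X \<inter> set Y = {}"
  proof (rule ccontr)
    assume "set X \<inter> set Y \<noteq> {}"
    then obtain a where "a \<le> s" "ear_vertex k w i a \<in> set Y" using X(7) by auto
    moreover from this have "a \<le> Suc w" using st(2) by simp
    ultimately show False using Y[of "ear_vertex k w i a" a i] by simp
  qed
  moreover have "set Y \<inter> set Z = {}"
  proof (rule ccontr)
    assume "set Y \<inter> set Z \<noteq> {}"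
    then obtain b where "b \<le> Suc w" "ear_vertex k w j b \<in> set Y" using setZ by auto
    then show False using Y[of "ear_vertex k w j b" b j] by simp
  qed
  moreover have "distinct Y" by (simp add: Y_def)
  ultimately have "distinct (X @ Y @ Z)"
    using X(1) Z(1) XZ by (simp add: Int_Un_distrib)
  moreover have "successively ?A (0 # Y @ [1])"
    using k st setY \<open>distinct Y\<close> by (intro successively_clique) auto
  then have "successively ?A (X @ Y @ Z)"
    using X Z Z_ends by (auto simp: successively_append_iff successively_Cons hd_append)
  moreover have "length (X @ Y @ Z) = w + 3" using st X(5) by (simp add: Y_def Z_def del: upt_Suc)
  moreover have "set (X @ Y @ Z) \<subseteq> verts ?G"
  proof -
    have "set Y \<subseteq> {..<k + q * w}" using setY st k by auto
    then show ?thesis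
      using X(7) setZ st ij k2 by (auto simp: eared_clique_def intro!: ear_vertex_lt)
  qed
  ultimately show ?thesis unfolding r_joined_def
    using X Z_ends by (intro exI[of _ "X @ Y @ Z"]) auto
qed

text \<open>
  Here the path enters the clique at \<open>0\<close> and fills up with clique vertices. Since
  \<open>s \<ge> 1\<close>, at most \<open>w\<close> of them are wanted, and \<open>k - 3 \<ge> w\<close> are at hand beside \<open>0\<close>, \<open>1\<close> and \<open>c\<close>.
\<close>

lemma ear_clique_joined:
  assumes k: "w + 3 \<le> k" and i: "i < q" and s: "1 \<le> s" "s \<le> w" and c: "2 \<le> c" "c < k"
  shows "r_joined (w + 3) (eared_clique k w q) (ear_vertex k w i s) c"
proof -
  let ?G = "eared_clique k w q"
  let ?A = "\<lambda>x y. {x, y} \<in> edges ?G"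
  define X where "X = ear_start k w i s"
  have k2: "2 \<le> k" using k by simp
  note X = ear_start[OF k2 i s(2), folded X_def]
  have "Suc w - s \<le> card ({2..<k} - {c})" using s k c by simp
  then obtain ys where ys: "distinct ys" "length ys = Suc w - s" "set ys \<subseteq> {2..<k} - {c}"
    using ex_distinct_list by meson
  have disj: "y \<notin> set X" if "y \<in> set (ys @ [c])" for y
  proof
    assume "y \<in> set X"
    then obtain a where "a \<le> s" "y = ear_vertex k w i a" using X(7) by auto
    moreover have "2 \<le> y" "y < k" using that ys c by auto
    ultimately show False using ear_vertex_in_clique[of k w i a] s by simp
  qed
  have "distinct (X @ ys @ [c])" using X(1) ys disj by auto
  moreover have "successively ?A (0 # ys @ [c])"
    using ys c by (intro successively_clique) auto
  then have "successively ?A (X @ ys @ [c])"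
    using X by (auto simp: successively_append_iff successively_Cons)
  moreover have "length (X @ ys @ [c]) = w + 3" using s X(5) ys by simp
  moreover have "set (X @ ys @ [c]) \<subseteq> verts ?G"
  proof -
    have "set (ys @ [c]) \<subseteq> {..<k + q * w}" using ys c by auto
    then show ?thesis
      using X(7) s i k2 by (auto simp: eared_clique_def intro!: ear_vertex_lt)
  qed
  ultimately show ?thesis unfolding r_joined_def
    using X by (intro exI[of _ "X @ ys @ [c]"]) auto
qed

lemma clique_clique_joined:
  assumes k: "r \<le> k" "2 \<le> r" and cd: "c < k" "d < k" "c \<noteq> d"
  shows "r_joined r (eared_clique k w q) c d"
proof -
  have "r - 2 \<le> card ({..<k} - {c, d})" using cd k by (simp add: card_Diff_subset)
  then obtain ys where ys: "distinct ys" "length ys = r - 2" "set ys \<subseteq> {..<k} - {c, d}"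
    using ex_distinct_list by meson
  have "distinct (c # ys @ [d])" "set (c # ys @ [d]) \<subseteq> {..<k}" using ys cd by auto
  moreover from this have "successively (\<lambda>x y. {x, y} \<in> edges (eared_clique k w q)) (c # ys @ [d])"
    by (rule successively_clique)
  moreover have "{..<k} \<subseteq> verts (eared_clique k w q)" by (auto simp: eared_clique_def)
  ultimately show ?thesis unfolding r_joined_def
    using ys k by (intro exI[of _ "c # ys @ [d]"]) auto
qed

lemma cov_sat_eared_clique:
  assumes k: "w + 3 \<le> k"
  shows "cov_sat (cycle_graph (w + 3)) (eared_clique k w q)"
proof (rule all_r_joined_imp_cov_sat)
  let ?J = "r_joined (w + 3) (eared_clique k w q)"
  show "graph (eared_clique k w q)" using k by (intro graph_eared_clique) simp
  \<comment> \<open>The attachment vertices count as ends of the ear that they are to be joined with.\<close>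
  have clique_ear: "?J c (ear_vertex k w j t)" if "c < k" "j < q" "1 \<le> t" "t \<le> w" for c j t
  proof -
    consider "c = 0" | "c = 1" | "2 \<le> c" by linarith
    then show ?thesis
    proof cases
      case 1
      then show ?thesis using ear_ear_joined[of w k j q j 0 t] that k by simp
    next
      case 2
      then show ?thesis using ear_ear_joined[of w k j q j t "Suc w"] that k
        by (intro r_joined_sym[of _ _ _ c]) simp
    next
      case 3
      then show ?thesis using ear_clique_joined that k by (intro r_joined_sym[of _ _ _ c]) simp
    qed
  qed
  fix u v assume uv: "u \<in> verts (eared_clique k w q)" "v \<in> verts (eared_clique k w q)" "u \<noteq> v"
  then have lt: "u < k + q * w" "v < k + q * w" by (auto simp: eared_clique_def)
  show "?J u v"
  proof (cases rule: eared_clique_vertex_cases[OF lt(1)])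
    case u: 1
    show ?thesis
    proof (cases rule: eared_clique_vertex_cases[OF lt(2)])
      case 1
      then show ?thesis using clique_clique_joined[of "w + 3" k u v w q] u uv(3) k by simp
    next
      case (2 j t)
      then show ?thesis using clique_ear[of u j t] u by simp
    qed
  next
    case u: (2 i s)
    show ?thesis
    proof (cases rule: eared_clique_vertex_cases[OF lt(2)])
      case 1
      then show ?thesis using clique_ear[of v i s] u by (intro r_joined_sym[of _ _ v]) simp
    next
      case v: (2 j t)
      have "s \<noteq> t \<or> i \<noteq> j" using u v uv(3) by auto
      show ?thesis
      proof (cases "s \<le> t")
        case True
        then show ?thesis
          using ear_ear_joined[of w k i q j s t] \<open>s \<noteq> t \<or> i \<noteq> j\<close> u v k by force
      next
        case False
        then show ?thesis
          using ear_ear_joined[of w k j q i t s] u v k by (intro r_joined_sym[of _ _ v]) simp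
      qed
    qed
  qed
qed simp

section \<open>Asymptotics\<close>

text \<open>
  The remainder of \<open>n - r\<close> modulo \<open>w\<close> goes into the clique, so its size stays at most \<open>2 w + 3\<close>. The
  eared clique is also what ensures that the minimum defining \<open>csat\<close> is attained, which the lower
  bound relies on.
\<close>

lemma csat_cycle_bounds:
  assumes w: "1 \<le> w" and n: "w + 3 \<le> n"
  shows "n \<le> csat n (cycle_graph (w + 3))"
    and "real (csat n (cycle_graph (w + 3))) \<le> 2 ^ (2 * w + 3) + (1 + 1 / real w) * real n"
proof -
  let ?P = "\<lambda>m. \<exists>G :: nat ugraph. graph G \<and> card (verts G) = n \<and>
    cov_sat (cycle_graph (w + 3)) G \<and> card (edges G) = m"
  define q where "q = (n - (w + 3)) div w"
  define k where "k = w + 3 + (n - (w + 3)) mod w"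
  have nk: "k + q * w = n"
    using n div_mult_mod_eq[of "n - (w + 3)" w] unfolding k_def q_def by linarith
  have k: "w + 3 \<le> k" "k \<le> 2 * w + 3"
    using w mod_less_divisor[of w "n - (w + 3)"] unfolding k_def by linarith+
  have P: "?P (card (edges (eared_clique k w q)))"
    using k nk graph_eared_clique[of k w q] cov_sat_eared_clique[of w k q]
    by (intro exI[of _ "eared_clique k w q"]) (simp add: eared_clique_def)
  have "?P (csat n (cycle_graph (w + 3)))"
    unfolding csat_def using P by (rule LeastI)
  then show "n \<le> csat n (cycle_graph (w + 3))"
    using card_verts_le_card_edges cov_sat_cycle_two_edges_at[of "w + 3"]
    by (metis le_add2)
  have "csat n (cycle_graph (w + 3)) \<le> card (edges (eared_clique k w q))"
    unfolding csat_def using P by (rule Least_le)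
  also have "\<dots> \<le> 2 ^ k + q * Suc w" by (rule card_edges_eared_clique)
  also have "\<dots> \<le> 2 ^ (2 * w + 3) + q * Suc w" using k by (simp add: power_increasing)
  finally have "real (csat n (cycle_graph (w + 3))) \<le> real (2 ^ (2 * w + 3) + q * Suc w)"
    by (rule of_nat_mono)
  moreover have "real (q * Suc w) \<le> (1 + 1 / real w) * real n"
  proof -
    have "real (q * Suc w) = (1 + 1 / real w) * real (q * w)" using w by (simp add: field_simps)
    also have "\<dots> \<le> (1 + 1 / real w) * real n"
      using nk by (intro mult_left_mono of_nat_mono) auto
    finally show ?thesis .
  qed
  ultimately show "real (csat n (cycle_graph (w + 3))) \<le> 2 ^ (2 * w + 3) + (1 + 1 / real w) * real n"
    by simp
qed

theorem theorem4p3: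
  fixes r :: nat
  assumes "r \<ge> 4"
  shows "1 \<le> liminf (\<lambda>n. ereal (real (csat n (cycle_graph r)) / real n))
    \<and> liminf (\<lambda>n. ereal (real (csat n (cycle_graph r)) / real n))
        \<le> limsup (\<lambda>n. ereal (real (csat n (cycle_graph r)) / real n))
    \<and> limsup (\<lambda>n. ereal (real (csat n (cycle_graph r)) / real n))
        \<le> ereal (1 + 1 / (real r - 3))"
proof -
  define w where "w = r - 3"
  have w: "1 \<le> w" "r = w + 3" "real r - 3 = real w" using assms by (auto simp: w_def)
  let ?f = "\<lambda>n. ereal (real (csat n (cycle_graph r)) / real n)"
  let ?g = "\<lambda>n. 2 ^ (2 * w + 3) / real n + (1 + 1 / real w)"
  have "1 \<le> ?f n" if "n \<ge> r" for n
    using csat_cycle_bounds(1)[of w n] that w(1) by (simp add: w(2))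
  then have "1 \<le> liminf ?f"
    by (intro Liminf_bounded) (auto simp: eventually_sequentially)
  moreover have "liminf ?f \<le> limsup ?f" by (intro Liminf_le_Limsup) simp
  moreover have "limsup ?f \<le> ereal (1 + 1 / real w)"
  proof -
    have "?f n \<le> ereal (?g n)" if "n \<ge> r" for n
      using csat_cycle_bounds(2)[of w n] that w(1)
      by (simp add: w(2) divide_le_eq distrib_right)
    then have "limsup ?f \<le> limsup (\<lambda>n. ereal (?g n))"
      by (intro Limsup_mono) (auto simp: eventually_sequentially)
    also have "?g \<longlonglongrightarrow> 0 + (1 + 1 / real w)"
      by (intro tendsto_add tendsto_const lim_const_over_n)
    then have "limsup (\<lambda>n. ereal (?g n)) = ereal (1 + 1 / real w)"
      by (intro lim_imp_Limsup) auto
    finally show ?thesis .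
  qed
  ultimately show ?thesis by (simp add: w(2))
qed

end
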